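(* Consider the multi-dimensional viscous conservation law $$\partial_tu+\sum_{j=1}^d\partial_{x_j}f_j(u)=\sum_{j=1}^d\partial_{x_j}\Big(\sum_{k=1}^dB_{jk}(u)\partial_{x_k}u\Big),\qquad u(x,t)\in\Omega_u\subset\mathbb R^n,$$ with smooth $f_j:\Omega_u\to\mathbb R^n$ and smooth $B_{jk}:\Omega_u\to\mathbb R^{n\times n}$. Assume: (A1) there exist a smooth scalar entropy function $\eta(u)$ and entropy fluxes $g_j(u)$ with Hessian $\eta_{uu}(u)$ positive definite and $\partial_ug_j=\eta_u\,\partial_uf_j$, $j=1,\dots,d$; (A2) the $nd\times nd$ matrix $\mathrm{diag}\{\eta_{uu},\dots,\eta_{uu}\}\,B$ is symmetric positive definite, where $B=(B_{jk}(u))_{j,k=1}^d\in\mathbb R^{nd\times nd}$. Let $a\in\mathbb R$ be a constant. Then the relaxation system for $U=(u,w_1,\dots,w_d)$, $w_i\in\mathbb R^n$, $$\begin{aligned} &\partial_tu+\frac1\varepsilon\sum_{j=1}^d\partial_{x_j}w_j=0, \\ &\partial_tw_i+\frac1\varepsilon\sum_{j=1}^d\big(B_{ij}(u)+\varepsilon^2a^2I_n\big)\partial_{x_j}u=\frac1{\varepsilon^2}\big(\varepsilon f_i(u)-w_i\big),\quad i=1,\dots,d,\end{aligned}$$ satisfies the convergence criteria (i)-(v) listed in the context (with $w=(w_1,\dots,w_d)$), and its limit equation (as defined in the context) is the viscous conservation law above.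
   Context: Convergence criteria. Let $\partial_tU+\frac1\varepsilon\sum_{j=1}^dA_j(U;\varepsilon)\partial_{x_j}U=\frac1{\varepsilon^2}Q(U;\varepsilon)$ be a first-order system for $U=(u,w)^T\in\Omega\subset\mathbb R^{n'}$, $u\in\mathbb R^{n'-r}$, $w\in\mathbb R^r$, with parameter $\varepsilon\in(0,1]$; $A_j$ and $Q$ are smooth in $(U;\varepsilon)$, up to $\varepsilon=0$. $\Omega_u\subset\mathbb R^{n'-r}$ is an open convex set (the state space of $u$), $\Omega$ is open, $(u,w)\in\Omega$ implies $u\in\Omega_u$, and $(u,0)\in\Omega$ for $u\in\Omega_u$. An $n'\times n'$ matrix $A$ is partitioned as $\begin{pmatrix} A^{11} & A^{12} \\ A^{21} & A^{22} \end{pmatrix}$ according to $n'=(n'-r)+r$. The criteria are: (i) $Q(U;\varepsilon)=(0,q(U;\varepsilon))^T$ with $q$ a smooth $\mathbb R^r$-valued function. (ii) $q(u,w;0)=0$ if and only if $w=0$, and $\partial_wq(u,0;0)$ is invertible for all $u\in\Omega_u$. (iii) There is a symmetric positive definite matrix $A_0(U;\varepsilon)$ (symmetrizer) such that $A_0(U;\varepsilon)A_j(U;\varepsilon)=A_j(U;\varepsilon)^TA_0(U;\varepsilon)$ for all $U\in\Omega$ and all $j$. (iv) With this $A_0$, there is a symmetric positive definite $r\times r$ matrix $S(u)$ such that $A_0(u,0;0)\,\partial_UQ(u,0;0)+(\partial_UQ(u,0;0))^TA_0(u,0;0)\le-\begin{pmatrix} 0 & 0 \\ 0 & S(u) \end{pmatrix}$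 for all $u\in\Omega_u$. (v) $A_j^{11}(u,0;0)=0$ and $\partial_uA_j^{11}(u,0;0)=0$ for all $u\in\Omega_u$ and all $j$. Limit equation. This is the equation for the leading term $u_0$ in the formal expansion $u\sim u_0+\varepsilon u_1+\cdots$, $w\sim w_0+\varepsilon w_1+\cdots$; explicitly $w_0=0$, $w_1=\partial_wq(u_0,0;0)^{-1}\big[\sum_jA_j^{21}(u_0,0;0)\partial_{x_j}u_0-\partial_\varepsilon q(u_0,0;0)\big]$ and $$\partial_tu_0+\sum_jA_j^{12}(u_0,0;0)\partial_{x_j}w_1+\sum_j\big(\partial_wA_j^{11}(u_0,0;0)[w_1]\big)\partial_{x_j}u_0+\sum_j\partial_\varepsilon A_j^{11}(u_0,0;0)\partial_{x_j}u_0=0.$$ For the system in the claim, $n'=n+nd$, $r=nd$. *)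

theory Defs
  imports "HOL-Analysis.Analysis"
begin

section \<open>Smooth maps\<close>

text \<open>
  The \<open>k\<close>-fold continuous differentiability below is meant for open sets: the derivatives are
  two-sided (\<open>at x\<close>), and one differentiates repeatedly along fixed directions.
\<close>

primrec Ck_on :: "nat \<Rightarrow> 'a::real_normed_vector set \<Rightarrow> ('a \<Rightarrow> 'b::real_normed_vector) \<Rightarrow> bool" where
  "Ck_on 0 S f \<longleftrightarrow> continuous_on S f"
| "Ck_on (Suc k) S f \<longleftrightarrow>
     (\<forall>x\<in>S. f differentiable (at x)) \<and> (\<forall>v. Ck_on k S (\<lambda>x. frechet_derivative f (at x) v))"

definition smooth_on :: "'a::real_normed_vector set \<Rightarrow> ('a \<Rightarrow> 'b::real_normed_vector) \<Rightarrow> bool" where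
  "smooth_on S f \<longleftrightarrow> (\<forall>k. Ck_on k S f)"

text \<open>
  Smoothness on a set that need not be open, such as \<open>\<Omega> \<times> {0..1}\<close>: there is a smooth extension to
  an open neighbourhood. This expresses smoothness up to the boundary \<open>\<epsilon> = 0\<close>.
\<close>

definition smooth_up_to :: "'a::real_normed_vector set \<Rightarrow> ('a \<Rightarrow> 'b::real_normed_vector) \<Rightarrow> bool" where
  "smooth_up_to S f \<longleftrightarrow> (\<exists>T g. open T \<and> S \<subseteq> T \<and> smooth_on T g \<and> (\<forall>x\<in>S. g x = f x))"


section \<open>Partitioned vectors and matrices\<close>

text \<open>
  The state space \<open>\<real>\<^sup>n\<^sup>'\<close> with \<open>n' = (n' - r) + r\<close> is \<open>real ^ ('p + 'r)\<close>, where \<open>CARD('p) = n' - r\<close>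
  and \<open>CARD('r) = r\<close>.
\<close>

definition join :: "real ^ 'p \<Rightarrow> real ^ 'r \<Rightarrow> real ^ ('p::finite + 'r::finite)" where
  "join u w = (\<chi> s. case s of Inl i \<Rightarrow> u $ i | Inr k \<Rightarrow> w $ k)"

definition ucomp :: "real ^ ('p::finite + 'r::finite) \<Rightarrow> real ^ 'p" where
  "ucomp U = (\<chi> i. U $ Inl i)"

definition wcomp :: "real ^ ('p::finite + 'r::finite) \<Rightarrow> real ^ 'r" where
  "wcomp U = (\<chi> k. U $ Inr k)"

definition block_matrix ::
  "real ^ 'p ^ 'p \<Rightarrow> real ^ 'r ^ 'p \<Rightarrow> real ^ 'p ^ 'r \<Rightarrow> real ^ 'r ^ 'r
    \<Rightarrow> real ^ ('p::finite + 'r::finite) ^ ('p + 'r)" where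
  "block_matrix M11 M12 M21 M22 =
     (\<chi> s t. case s of
        Inl i \<Rightarrow> (case t of Inl j \<Rightarrow> M11 $ i $ j | Inr l \<Rightarrow> M12 $ i $ l)
      | Inr k \<Rightarrow> (case t of Inl j \<Rightarrow> M21 $ k $ j | Inr l \<Rightarrow> M22 $ k $ l))"

definition blk11 :: "real ^ ('p::finite + 'r::finite) ^ ('p + 'r) \<Rightarrow> real ^ 'p ^ 'p" where
  "blk11 M = (\<chi> i j. M $ Inl i $ Inl j)"

definition blk12 :: "real ^ ('p::finite + 'r::finite) ^ ('p + 'r) \<Rightarrow> real ^ 'r ^ 'p" where
  "blk12 M = (\<chi> i l. M $ Inl i $ Inr l)"

definition blk21 :: "real ^ ('p::finite + 'r::finite) ^ ('p + 'r) \<Rightarrow> real ^ 'p ^ 'r" where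
  "blk21 M = (\<chi> k j. M $ Inr k $ Inl j)"

definition pos_def :: "real ^ 'n ^ 'n::finite \<Rightarrow> bool" where
  "pos_def M \<longleftrightarrow> (\<forall>x. x \<noteq> 0 \<longrightarrow> 0 < x \<bullet> (M *v x))"

definition sym_pos_def :: "real ^ 'n ^ 'n::finite \<Rightarrow> bool" where
  "sym_pos_def M \<longleftrightarrow> transpose M = M \<and> pos_def M"

definition loewner_le :: "real ^ 'n ^ 'n::finite \<Rightarrow> real ^ 'n ^ 'n \<Rightarrow> bool" where
  "loewner_le M N \<longleftrightarrow> (\<forall>x. x \<bullet> (M *v x) \<le> x \<bullet> (N *v x))"


section \<open>Differential operators\<close>

definition hessian :: "(real ^ 'n::finite \<Rightarrow> real) \<Rightarrow> real ^ 'n \<Rightarrow> real ^ 'n ^ 'n" where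
  "hessian F x =
     (\<chi> i j. frechet_derivative (\<lambda>y. frechet_derivative F (at y) (axis j 1)) (at x) (axis i 1))"

text \<open>Functions of \<open>(x, t)\<close> have domain \<open>(real ^ 'd) \<times> real\<close>.\<close>

definition dt :: "((real ^ 'd::finite) \<times> real \<Rightarrow> 'b::real_normed_vector) \<Rightarrow> (real ^ 'd) \<times> real \<Rightarrow> 'b" where
  "dt v p = vector_derivative (\<lambda>s. v (fst p, s)) (at (snd p))"

definition dx ::
  "'d::finite \<Rightarrow> ((real ^ 'd) \<times> real \<Rightarrow> 'b::real_normed_vector) \<Rightarrow> (real ^ 'd) \<times> real \<Rightarrow> 'b" where
  "dx j v p = vector_derivative (\<lambda>s. v (fst p + s *\<^sub>R axis j 1, snd p)) (at 0)"

text \<open>The parameter only ranges over \<open>[0, 1]\<close>, so its derivative at \<open>\<epsilon> = 0\<close> is one-sided.\<close>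

definition deps0 :: "(real \<Rightarrow> 'b::real_normed_vector) \<Rightarrow> 'b" where
  "deps0 h = vector_derivative h (at 0 within {0..1})"


section \<open>First-order systems with small parameter\<close>

text \<open>
  Coefficients are given by \<open>A :: 'd \<Rightarrow> state \<Rightarrow> real \<Rightarrow> matrix\<close> and \<open>Q :: state \<Rightarrow> real \<Rightarrow> state\<close>,
  the last argument being \<open>\<epsilon>\<close>; their values matter only for states in \<open>\<Omega>\<close> and \<open>\<epsilon> \<in> [0, 1]\<close>.
\<close>

definition first_order_system ::
  "('d::finite \<Rightarrow> real ^ 'm \<Rightarrow> real \<Rightarrow> real ^ 'm ^ 'm) \<Rightarrow> (real ^ 'm \<Rightarrow> real \<Rightarrow> real ^ 'm) \<Rightarrow> real
    \<Rightarrow> ((real ^ 'd) \<times> real \<Rightarrow> real ^ 'm::finite) \<Rightarrow> (real ^ 'd) \<times> real \<Rightarrow> bool" where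
  "first_order_system A Q \<epsilon> U p \<longleftrightarrow>
     dt U p + (1 / \<epsilon>) *\<^sub>R (\<Sum>j\<in>UNIV. A j (U p) \<epsilon> *v dx j U p) = (1 / \<epsilon>\<^sup>2) *\<^sub>R Q (U p) \<epsilon>"

definition state_spaces ::
  "(real ^ 'p) set \<Rightarrow> (real ^ ('p::finite + 'r::finite)) set \<Rightarrow> bool" where
  "state_spaces \<Omega>u \<Omega> \<longleftrightarrow>
     open \<Omega>u \<and> convex \<Omega>u \<and> open \<Omega> \<and> (\<forall>U\<in>\<Omega>. ucomp U \<in> \<Omega>u) \<and> (\<forall>u\<in>\<Omega>u. join u 0 \<in> \<Omega>)"

definition smooth_coefficients ::
  "(real ^ ('p::finite + 'r::finite)) set \<Rightarrow>
   ('d::finite \<Rightarrow> real ^ ('p + 'r) \<Rightarrow> real \<Rightarrow> real ^ ('p + 'r) ^ ('p + 'r)) \<Rightarrow>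
   (real ^ ('p + 'r) \<Rightarrow> real \<Rightarrow> real ^ ('p + 'r)) \<Rightarrow> bool" where
  "smooth_coefficients \<Omega> A Q \<longleftrightarrow>
     (\<forall>j. smooth_up_to (\<Omega> \<times> {0..1}) (\<lambda>(U, \<epsilon>). A j U \<epsilon>)) \<and>
     smooth_up_to (\<Omega> \<times> {0..1}) (\<lambda>(U, \<epsilon>). Q U \<epsilon>)"

text \<open>The function \<open>q\<close> with \<open>Q = (0, q)\<close>.\<close>

definition qpart ::
  "(real ^ ('p::finite + 'r::finite) \<Rightarrow> real \<Rightarrow> real ^ ('p + 'r)) \<Rightarrow> real ^ ('p + 'r) \<Rightarrow> real \<Rightarrow> real ^ 'r" where
  "qpart Q U \<epsilon> = wcomp (Q U \<epsilon>)"

text \<open>\<open>\<partial>\<^sub>w q(u, 0; 0)\<close>\<close>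

definition dwq ::
  "(real ^ ('p::finite + 'r::finite) \<Rightarrow> real \<Rightarrow> real ^ ('p + 'r)) \<Rightarrow> real ^ 'p \<Rightarrow> real ^ 'r ^ 'r" where
  "dwq Q u = jacobian (\<lambda>w. qpart Q (join u w) 0) (at 0)"

definition criterion_i ::
  "(real ^ ('p::finite + 'r::finite)) set \<Rightarrow> (real ^ ('p + 'r) \<Rightarrow> real \<Rightarrow> real ^ ('p + 'r)) \<Rightarrow> bool" where
  "criterion_i \<Omega> Q \<longleftrightarrow>
     (\<forall>U\<in>\<Omega>. \<forall>\<epsilon>\<in>{0..1}. Q U \<epsilon> = join 0 (qpart Q U \<epsilon>)) \<and>
     smooth_up_to (\<Omega> \<times> {0..1}) (\<lambda>(U, \<epsilon>). qpart Q U \<epsilon>)"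

definition criterion_ii ::
  "(real ^ 'p) set \<Rightarrow> (real ^ ('p::finite + 'r::finite)) set \<Rightarrow>
   (real ^ ('p + 'r) \<Rightarrow> real \<Rightarrow> real ^ ('p + 'r)) \<Rightarrow> bool" where
  "criterion_ii \<Omega>u \<Omega> Q \<longleftrightarrow>
     (\<forall>u w. join u w \<in> \<Omega> \<longrightarrow> (qpart Q (join u w) 0 = 0 \<longleftrightarrow> w = 0)) \<and>
     (\<forall>u\<in>\<Omega>u. invertible (dwq Q u))"

definition criterion_iii ::
  "(real ^ ('p::finite + 'r::finite)) set \<Rightarrow>
   ('d::finite \<Rightarrow> real ^ ('p + 'r) \<Rightarrow> real \<Rightarrow> real ^ ('p + 'r) ^ ('p + 'r)) \<Rightarrow>
   (real ^ ('p + 'r) \<Rightarrow> real \<Rightarrow> real ^ ('p + 'r) ^ ('p + 'r)) \<Rightarrow> bool" where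
  "criterion_iii \<Omega> A A0 \<longleftrightarrow>
     (\<forall>U\<in>\<Omega>. \<forall>\<epsilon>\<in>{0..1}.
        sym_pos_def (A0 U \<epsilon>) \<and> (\<forall>j. A0 U \<epsilon> ** A j U \<epsilon> = transpose (A j U \<epsilon>) ** A0 U \<epsilon>))"

definition criterion_iv ::
  "(real ^ 'p) set \<Rightarrow> (real ^ ('p::finite + 'r::finite) \<Rightarrow> real \<Rightarrow> real ^ ('p + 'r)) \<Rightarrow>
   (real ^ ('p + 'r) \<Rightarrow> real \<Rightarrow> real ^ ('p + 'r) ^ ('p + 'r)) \<Rightarrow> bool" where
  "criterion_iv \<Omega>u Q A0 \<longleftrightarrow>
     (\<exists>S. \<forall>u\<in>\<Omega>u. sym_pos_def (S u) \<and>
        (let M = A0 (join u 0) 0; DQ = jacobian (\<lambda>U. Q U 0) (at (join u 0))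
         in loewner_le (M ** DQ + transpose DQ ** M) (- block_matrix 0 0 0 (S u))))"

definition criterion_v ::
  "(real ^ 'p) set \<Rightarrow>
   ('d::finite \<Rightarrow> real ^ ('p::finite + 'r::finite) \<Rightarrow> real \<Rightarrow> real ^ ('p + 'r) ^ ('p + 'r)) \<Rightarrow> bool" where
  "criterion_v \<Omega>u A \<longleftrightarrow>
     (\<forall>u\<in>\<Omega>u. \<forall>j. blk11 (A j (join u 0) 0) = 0 \<and>
        ((\<lambda>v. blk11 (A j (join v 0) 0)) has_derivative (\<lambda>_. 0)) (at u))"

text \<open>The same symmetrizer \<open>A0\<close> must serve in (iii) and (iv).\<close>

definition convergence_criteria ::
  "(real ^ 'p) set \<Rightarrow> (real ^ ('p::finite + 'r::finite)) set \<Rightarrow>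
   ('d::finite \<Rightarrow> real ^ ('p + 'r) \<Rightarrow> real \<Rightarrow> real ^ ('p + 'r) ^ ('p + 'r)) \<Rightarrow>
   (real ^ ('p + 'r) \<Rightarrow> real \<Rightarrow> real ^ ('p + 'r)) \<Rightarrow> bool" where
  "convergence_criteria \<Omega>u \<Omega> A Q \<longleftrightarrow>
     criterion_i \<Omega> Q \<and> criterion_ii \<Omega>u \<Omega> Q \<and>
     (\<exists>A0. criterion_iii \<Omega> A A0 \<and> criterion_iv \<Omega>u Q A0) \<and>
     criterion_v \<Omega>u A"


section \<open>The limit equation\<close>

text \<open>
  The term \<open>w\<^sub>1\<close> of the expansion, as determined by the leading term \<open>u\<^sub>0\<close> (and \<open>w\<^sub>0 = 0\<close>).
\<close>

definition w1_term ::
  "('d::finite \<Rightarrow> real ^ ('p::finite + 'r::finite) \<Rightarrow> real \<Rightarrow> real ^ ('p + 'r) ^ ('p + 'r)) \<Rightarrow>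
   (real ^ ('p + 'r) \<Rightarrow> real \<Rightarrow> real ^ ('p + 'r)) \<Rightarrow>
   ((real ^ 'd) \<times> real \<Rightarrow> real ^ 'p) \<Rightarrow> (real ^ 'd) \<times> real \<Rightarrow> real ^ 'r" where
  "w1_term A Q u0 p =
     matrix_inv (dwq Q (u0 p)) *v
       ((\<Sum>j\<in>UNIV. blk21 (A j (join (u0 p) 0) 0) *v dx j u0 p)
         - deps0 (\<lambda>\<epsilon>. qpart Q (join (u0 p) 0) \<epsilon>))"

definition limit_equation ::
  "('d::finite \<Rightarrow> real ^ ('p::finite + 'r::finite) \<Rightarrow> real \<Rightarrow> real ^ ('p + 'r) ^ ('p + 'r)) \<Rightarrow>
   (real ^ ('p + 'r) \<Rightarrow> real \<Rightarrow> real ^ ('p + 'r)) \<Rightarrow>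
   ((real ^ 'd) \<times> real \<Rightarrow> real ^ 'p) \<Rightarrow> (real ^ 'd) \<times> real \<Rightarrow> bool" where
  "limit_equation A Q u0 p \<longleftrightarrow>
     dt u0 p
     + (\<Sum>j\<in>UNIV. blk12 (A j (join (u0 p) 0) 0) *v dx j (w1_term A Q u0) p)
     + (\<Sum>j\<in>UNIV. frechet_derivative (\<lambda>w. blk11 (A j (join (u0 p) w) 0)) (at 0) (w1_term A Q u0 p)
          *v dx j u0 p)
     + (\<Sum>j\<in>UNIV. deps0 (\<lambda>\<epsilon>. blk11 (A j (join (u0 p) 0) \<epsilon>)) *v dx j u0 p)
     = 0"


section \<open>Viscous conservation laws and their relaxation\<close>

definition viscous_conservation_law ::
  "('d \<Rightarrow> real ^ 'n \<Rightarrow> real ^ 'n) \<Rightarrow> ('d \<Rightarrow> 'd \<Rightarrow> real ^ 'n \<Rightarrow> real ^ 'n ^ 'n) \<Rightarrow>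
   ((real ^ 'd::finite) \<times> real \<Rightarrow> real ^ 'n::finite) \<Rightarrow> (real ^ 'd) \<times> real \<Rightarrow> bool" where
  "viscous_conservation_law f B u p \<longleftrightarrow>
     dt u p + (\<Sum>j\<in>UNIV. dx j (\<lambda>y. f j (u y)) p)
     = (\<Sum>j\<in>UNIV. dx j (\<lambda>y. \<Sum>k\<in>UNIV. B j k (u y) *v dx k u y) p)"

text \<open>
  \<open>\<real>\<^sup>n\<^sup>d\<close> is \<open>real ^ ('d \<times> 'n)\<close>; the index \<open>(i, k)\<close> is the \<open>k\<close>-th component of the \<open>i\<close>-th block.
\<close>

definition block :: "'d \<Rightarrow> real ^ ('d::finite \<times> 'n::finite) \<Rightarrow> real ^ 'n" where
  "block i w = (\<chi> k. w $ (i, k))"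

definition assemble ::
  "('d \<Rightarrow> 'd \<Rightarrow> real ^ 'n ^ 'n) \<Rightarrow> real ^ ('d::finite \<times> 'n::finite) ^ ('d \<times> 'n)" where
  "assemble M = (\<chi> s t. M (fst s) (fst t) $ snd s $ snd t)"

definition block_diag :: "real ^ 'n ^ 'n \<Rightarrow> real ^ ('d::finite \<times> 'n::finite) ^ ('d \<times> 'n)" where
  "block_diag H = assemble (\<lambda>i j. if i = j then H else 0)"

definition relaxation_system ::
  "('d \<Rightarrow> real ^ 'n \<Rightarrow> real ^ 'n) \<Rightarrow> ('d \<Rightarrow> 'd \<Rightarrow> real ^ 'n \<Rightarrow> real ^ 'n ^ 'n) \<Rightarrow> real \<Rightarrow> real \<Rightarrow>
   ((real ^ 'd::finite) \<times> real \<Rightarrow> real ^ 'n::finite) \<Rightarrow> ('d \<Rightarrow> (real ^ 'd) \<times> real \<Rightarrow> real ^ 'n) \<Rightarrow>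
   (real ^ 'd) \<times> real \<Rightarrow> bool" where
  "relaxation_system f B a \<epsilon> u w p \<longleftrightarrow>
     dt u p + (1 / \<epsilon>) *\<^sub>R (\<Sum>j\<in>UNIV. dx j (w j) p) = 0 \<and>
     (\<forall>i. dt (w i) p
          + (1 / \<epsilon>) *\<^sub>R (\<Sum>j\<in>UNIV. (B i j (u p) + (\<epsilon>\<^sup>2 * a\<^sup>2) *\<^sub>R mat 1) *v dx j u p)
          = (1 / \<epsilon>\<^sup>2) *\<^sub>R (\<epsilon> *\<^sub>R f i (u p) - w i p))"

text \<open>The coefficients of the relaxation system, read as a first-order system for \<open>(u, w)\<close>.\<close>

definition relax_A ::
  "('d \<Rightarrow> 'd \<Rightarrow> real ^ 'n \<Rightarrow> real ^ 'n ^ 'n) \<Rightarrow> real \<Rightarrow> 'd \<Rightarrow> real ^ ('n::finite + 'd::finite \<times> 'n) \<Rightarrow> real \<Rightarrow>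
   real ^ ('n + 'd \<times> 'n) ^ ('n + 'd \<times> 'n)" where
  "relax_A B a j U \<epsilon> =
     block_matrix
       0
       (\<chi> k t. if t = (j, k) then 1 else 0)
       (\<chi> s l. (B (fst s) j (ucomp U) + (\<epsilon>\<^sup>2 * a\<^sup>2) *\<^sub>R mat 1) $ snd s $ l)
       0"

definition relax_Q ::
  "('d \<Rightarrow> real ^ 'n \<Rightarrow> real ^ 'n) \<Rightarrow> real ^ ('n::finite + 'd::finite \<times> 'n) \<Rightarrow> real \<Rightarrow> real ^ ('n + 'd \<times> 'n)" where
  "relax_Q f U \<epsilon> =
     join 0 (\<chi> s. (\<epsilon> *\<^sub>R f (fst s) (ucomp U) - block (fst s) (wcomp U)) $ snd s)"

end

theory Submission
  imports Defs
begin

text \<open>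
  Write the relaxation system with the \<open>nd \<times> nd\<close> matrix \<open>C\<close> whose blocks are \<open>B\<^sub>i\<^sub>j + \<epsilon>\<^sup>2 a\<^sup>2 I\<close>, and put
  \<open>H = \<eta>\<^sub>u\<^sub>u\<close>, \<open>D = diag(H, \<dots>, H)\<close>. A matrix \<open>diag(H, K)\<close> symmetrizes all \<open>A\<^sub>j\<close> as soon as \<open>K C = D\<close> with
  \<open>K\<close> symmetric, which \<open>K = D (D C)\<^sup>-\<^sup>1 D\<close> achieves. Here \<open>D C\<close> is symmetric positive definite because it
  differs from \<open>D B\<close> by the positive semidefinite matrix \<open>\<epsilon>\<^sup>2 a\<^sup>2 (H)\<^sub>i\<^sub>j\<close>, all of whose blocks are \<open>H\<close>.
  Since \<open>\<partial>\<^sub>UQ = diag(0, -I)\<close> at \<open>\<epsilon> = 0\<close>, criterion (iv) holds with equality for \<open>S = 2 K\<close>, and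
  \<open>w\<^sub>1 = f(u\<^sub>0) - B \<nabla>u\<^sub>0\<close> turns the limit equation into the viscous conservation law.
\<close>

subsection \<open>Finitely often differentiable maps\<close>

text \<open>On an open set a derivative depends only on values inside the set. The induction is over
  all \<open>f\<close> and \<open>g\<close>, because its hypothesis is applied to their directional
  derivatives.\<close>

lemma Ck_on_cong:
  assumes "open S" "\<And>x. x \<in> S \<Longrightarrow> f x = g x"
  shows "Ck_on k S f \<longleftrightarrow> Ck_on k S g"
  using assms(2)
proof (induction k arbitrary: f g)
  case 0
  then show ?case by (simp cong: continuous_on_cong)
next
  case (Suc k)
  have diff: "f differentiable (at x) \<longleftrightarrow> g differentiable (at x)" if "x \<in> S" for x
    using has_derivative_transform_within_open[OF _ assms(1) that] Suc.prems
    unfolding differentiable_def by metis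
  have "frechet_derivative f (at x) = frechet_derivative g (at x)"
    if "f differentiable (at x)" "x \<in> S" for x
    using frechet_derivative_transform_within_open[OF that(1) assms(1) that(2)] Suc.prems by blast
  then have "Ck_on k S (\<lambda>x. frechet_derivative f (at x) v) \<longleftrightarrow> Ck_on k S (\<lambda>x. frechet_derivative g (at x) v)"
    if "\<forall>x\<in>S. f differentiable (at x)" for v
    using that by (intro Suc.IH) auto
  with diff show ?case
    by auto
qed

lemma Ck_on_SucD: "Ck_on (Suc k) S f \<Longrightarrow> Ck_on k S f"
proof (induction k arbitrary: f)
  case 0
  then show ?case
    by (auto intro!: continuous_at_imp_continuous_on differentiable_imp_continuous_within)
next
  case (Suc k)
  \<comment> \<open>Goal and premise are each unfolded exactly once, so that the induction
    hypothesis meets the directional derivatives.\<close>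
  show ?case
    unfolding Ck_on.simps(2)[of k] using Suc.IH Suc.prems by (auto simp del: Ck_on.simps(2) simp: Ck_on.simps(2)[of "Suc k"])
qed

lemma Ck_on_imp_continuous_on: "Ck_on k S f \<Longrightarrow> continuous_on S f"
  by (induction k) (auto dest: Ck_on_SucD simp del: Ck_on.simps(2))

lemma Ck_on_const [intro]: "Ck_on k S (\<lambda>_. c)"
  by (induction k arbitrary: c) auto

text \<open>\<open>frechet_derivative\<close> is a choice operator. This rule lets the closure
  properties below work with the explicit formula that a differentiation rule supplies.\<close>

lemma Ck_on_SucI:
  assumes "open S" "\<And>x. x \<in> S \<Longrightarrow> (f has_derivative f' x) (at x)"
    and "\<And>v. Ck_on k S (\<lambda>x. f' x v)"
  shows "Ck_on (Suc k) S f"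
proof -
  have "frechet_derivative f (at x) = f' x" if "x \<in> S" for x
    using assms(2)[OF that] by (rule frechet_derivative_at[symmetric])
  with assms show ?thesis
    by (auto simp: differentiable_def cong: Ck_on_cong)
qed

lemma Ck_on_SucE:
  assumes "Ck_on (Suc k) S f"
  shows "x \<in> S \<Longrightarrow> (f has_derivative frechet_derivative f (at x)) (at x)"
    and "Ck_on k S (\<lambda>x. frechet_derivative f (at x) v)"
  using assms by (auto simp: frechet_derivative_works[symmetric])

lemma Ck_on_add:
  assumes "open S" "Ck_on k S f" "Ck_on k S g"
  shows "Ck_on k S (\<lambda>x. f x + g x)"
  using assms(2,3)
proof (induction k arbitrary: f g)
  case 0
  then show ?case by (simp add: continuous_on_add)
next
  case (Suc k)
  show ?case
    by (rule Ck_on_SucI[OF assms(1) has_derivative_add[OF Ck_on_SucE(1)[OF Suc.prems(1)] Ck_on_SucE(1)[OF Suc.prems(2)]]])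
      (auto intro!: Suc.IH Ck_on_SucE(2) Suc.prems simp del: Ck_on.simps)
qed

lemma Ck_on_sum:
  assumes "open S" "\<And>i. i \<in> I \<Longrightarrow> Ck_on k S (f i)"
  shows "Ck_on k S (\<lambda>x. \<Sum>i\<in>I. f i x)"
  using assms(2)
  by (induction I rule: infinite_finite_induct) (auto intro!: Ck_on_add[OF assms(1)])

lemma Ck_on_bounded_linear:
  assumes "open S" "bounded_linear L" "Ck_on k S f"
  shows "Ck_on k S (\<lambda>x. L (f x))"
  using assms(3)
proof (induction k arbitrary: f)
  case 0
  then show ?case by (simp add: bounded_linear.continuous_on[OF assms(2)])
next
  case (Suc k)
  show ?case
    by (rule Ck_on_SucI[OF assms(1) bounded_linear.has_derivative[OF assms(2) Ck_on_SucE(1)[OF Suc.prems]]])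
      (auto intro!: Suc.IH Ck_on_SucE(2) Suc.prems simp del: Ck_on.simps)
qed

text \<open>The derivative of the composite in direction \<open>v\<close> is again a derivative of
  \<open>f\<close>, in the fixed direction \<open>L v\<close>, composed with \<open>L\<close>; the
  induction therefore closes. It is applied to the projection of (U, \<epsilon>) to u.\<close>

lemma Ck_on_compose_bounded_linear:
  assumes "open T" "bounded_linear L" "L ` T \<subseteq> S" "Ck_on k S f"
  shows "Ck_on k T (\<lambda>x. f (L x))"
  using assms(4)
proof (induction k arbitrary: f)
  case 0
  then show ?case
    using continuous_on_compose2[OF _ bounded_linear.continuous_on[OF assms(2) continuous_on_id] assms(3)]
    by simp
next
  case (Suc k)
  have "((\<lambda>x. f (L x)) has_derivative (\<lambda>v. frechet_derivative f (at (L x)) (L v))) (at x)"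
    if "x \<in> T" for x
    using has_derivative_compose[OF bounded_linear.has_derivative[OF assms(2) has_derivative_ident]
        Ck_on_SucE(1)[OF Suc.prems, of "L x"]] assms(3) that
    by auto
  then show ?case
    by (rule Ck_on_SucI[OF assms(1)]) (auto intro!: Suc.IH Ck_on_SucE(2) Suc.prems simp del: Ck_on.simps)
qed

lemma Ck_on_linear:
  assumes "open S" "bounded_linear L"
  shows "Ck_on k S L"
proof (cases k)
  case 0
  then show ?thesis by (simp add: linear_continuous_on assms)
next
  case (Suc k)
  show ?thesis
    unfolding Suc
    by (rule Ck_on_SucI[OF assms(1) bounded_linear.has_derivative[OF assms(2) has_derivative_ident]]) auto
qed

text \<open>The product rule leaves one factor undifferentiated in each term, and
  \<open>Ck_on_SucD\<close> lowers its order to match the induction hypothesis.\<close>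

lemma Ck_on_scaleR:
  assumes "open S" "Ck_on k S c" "Ck_on k S f"
  shows "Ck_on k S (\<lambda>x. c x *\<^sub>R f x)"
  using assms(2,3)
proof (induction k arbitrary: c f)
  case 0
  then show ?case by (simp add: continuous_on_scaleR)
next
  case (Suc k)
  show ?case
    by (rule Ck_on_SucI[OF assms(1) has_derivative_scaleR[OF Ck_on_SucE(1)[OF Suc.prems(1)] Ck_on_SucE(1)[OF Suc.prems(2)]]])
      (auto intro!: Suc.IH Ck_on_add[OF assms(1)] Ck_on_SucE(2) Suc.prems Suc.prems[THEN Ck_on_SucD] simp del: Ck_on.simps)
qed

subsection \<open>Symmetry of second derivatives\<close>

text \<open>The mixed second difference is the change, along \<open>v\<close>, of the increment
  \<open>?\<phi>\<close> in direction \<open>w\<close>. One mean value theorem along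
  \<open>v\<close> turns it into an increment of the \<open>v\<close>-derivative, a second one along
  \<open>w\<close> into the mixed derivative.\<close>

lemma second_difference_mean_value:
  fixes f :: "'a::real_normed_vector \<Rightarrow> real"
  assumes f: "\<And>y. y \<in> S \<Longrightarrow> (f has_derivative f' y) (at y)"
    and f': "\<And>y. y \<in> S \<Longrightarrow> ((\<lambda>z. f' z v) has_derivative f'' y) (at y)"
    and "0 < h"
    and S: "\<And>s t. s \<in> {0..h} \<Longrightarrow> t \<in> {0..h} \<Longrightarrow> x + s *\<^sub>R v + t *\<^sub>R w \<in> S"
  shows "\<exists>s\<in>{0..h}. \<exists>t\<in>{0..h}.
    f (x + h *\<^sub>R v + h *\<^sub>R w) - f (x + h *\<^sub>R v) - f (x + h *\<^sub>R w) + f x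
    = h\<^sup>2 * f'' (x + s *\<^sub>R v + t *\<^sub>R w) w"
proof -
  have along: "((\<lambda>s. F (p + s *\<^sub>R d)) has_real_derivative F' d) (at s)"
    if "(F has_derivative F') (at (p + s *\<^sub>R d))" for F :: "'a \<Rightarrow> real" and F' p d s
  proof -
    have "((\<lambda>s. F (p + s *\<^sub>R d)) has_derivative (\<lambda>r. F' (r *\<^sub>R d))) (at s)"
      using that by (intro has_derivative_compose[where f = "\<lambda>s. p + s *\<^sub>R d" and g = F])
        (auto intro!: derivative_eq_intros)
    moreover have "linear F'"
      using that has_derivative_linear by blast
    ultimately show ?thesis
      by (simp add: has_field_derivative_def linear_cmul mult_commute_abs)
  qed
  let ?\<phi> = "\<lambda>s. f (x + h *\<^sub>R w + s *\<^sub>R v) - f (x + s *\<^sub>R v)"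
  have "(?\<phi> has_real_derivative f' (x + h *\<^sub>R w + s *\<^sub>R v) v - f' (x + s *\<^sub>R v) v) (at s)"
    if "0 \<le> s" "s \<le> h" for s
    using S[of s h] S[of s 0] that \<open>0 < h\<close>
    by (intro DERIV_diff along f) (auto simp: algebra_simps)
  from MVT2[OF \<open>0 < h\<close> this] obtain s where s: "0 < s" "s < h"
    "?\<phi> h - ?\<phi> 0 = h * (f' (x + h *\<^sub>R w + s *\<^sub>R v) v - f' (x + s *\<^sub>R v) v)"
    by auto
  have "((\<lambda>t. f' (x + s *\<^sub>R v + t *\<^sub>R w) v) has_real_derivative f'' (x + s *\<^sub>R v + t *\<^sub>R w) w) (at t)"
    if "0 \<le> t" "t \<le> h" for t
    using S[of s t] that s by (intro along[where F="\<lambda>z. f' z v"] f') auto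
  from MVT2[OF \<open>0 < h\<close> this] obtain t where t: "0 < t" "t < h"
    "f' (x + s *\<^sub>R v + h *\<^sub>R w) v - f' (x + s *\<^sub>R v) v = h * f'' (x + s *\<^sub>R v + t *\<^sub>R w) w"
    by auto
  have "?\<phi> h - ?\<phi> 0 = h\<^sup>2 * f'' (x + s *\<^sub>R v + t *\<^sub>R w) w"
    using s(3) t(3) by (simp add: power2_eq_square algebra_simps)
  then show ?thesis
    using s t by (intro bexI[of _ s] bexI[of _ t]) (auto simp: algebra_simps)
qed

text \<open>The second difference is unchanged when \<open>v\<close> and \<open>w\<close> are
  swapped, so the two mixed derivatives agree at some two points of a small parallelogram at
  \<open>x\<close>. By continuity they cannot differ at \<open>x\<close>.\<close>

theorem second_derivative_symmetric:
  fixes f :: "'a::real_normed_vector \<Rightarrow> real"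
  assumes "open S" "x \<in> S" "Ck_on 2 S f"
  shows "frechet_derivative (\<lambda>y. frechet_derivative f (at y) v) (at x) w
       = frechet_derivative (\<lambda>y. frechet_derivative f (at y) w) (at x) v"
proof (rule ccontr)
  define G where "G v w y = frechet_derivative (\<lambda>y. frechet_derivative f (at y) v) (at y) w" for v w y
  assume neq: "frechet_derivative (\<lambda>y. frechet_derivative f (at y) v) (at x) w
    \<noteq> frechet_derivative (\<lambda>y. frechet_derivative f (at y) w) (at x) v"
  \<comment> \<open>Half the supposed gap: if each mixed derivative varies by less than
    \<open>e\<close> near \<open>x\<close>, their values there cannot meet.\<close>
  define e where "e = \<bar>G v w x - G w v x\<bar> / 2"
  have "e > 0"
    using neq by (auto simp: e_def G_def)
  have C1: "Ck_on (Suc (Suc 0)) S f"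
    using assms(3) by (simp add: numeral_2_eq_2)
  note C2 = Ck_on_SucE(2)[OF C1]
  have cont: "continuous_on S (G v w)" for v w
    unfolding G_def by (rule Ck_on_imp_continuous_on[OF Ck_on_SucE(2)[OF C2]])
  have "\<forall>\<^sub>F y in nhds x. y \<in> S \<and> dist (G v w y) (G v w x) < e \<and> dist (G w v y) (G w v x) < e"
  proof -
    have "isCont (G v w) x" for v w
      using cont assms(1,2) continuous_on_eq_continuous_at by blast
    then have "\<forall>\<^sub>F y in nhds x. dist (G v w y) (G v w x) < e" for v w
      using \<open>e > 0\<close> unfolding isCont_def tendsto_at_iff_tendsto_nhds by (auto dest: tendstoD)
    then show ?thesis
      using eventually_nhds_in_open[OF assms(1,2)] by (simp add: eventually_conj_iff)
  qed
  then obtain r where "r > 0" and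
    r: "\<And>y. dist y x < r \<Longrightarrow> y \<in> S \<and> dist (G v w y) (G v w x) < e \<and> dist (G w v y) (G w v x) < e"
    unfolding eventually_nhds_metric by blast
  \<comment> \<open>The parallelogram with sides \<open>h *\<^sub>R v\<close> and
    \<open>h *\<^sub>R w\<close> then lies in the ball of radius \<open>r\<close>; the summand 1
    keeps the denominator positive when both vectors vanish.\<close>
  define h where "h = r / (norm v + norm w + 1)"
  have "norm v + norm w + 1 > 0"
    by (simp add: add_nonneg_pos)
  then have "h > 0" and h: "h * (norm v + norm w) < r"
    using \<open>r > 0\<close> by (auto simp: h_def field_simps)
  have near: "dist (x + s *\<^sub>R v + t *\<^sub>R w) x < r" if "s \<in> {0..h}" "t \<in> {0..h}" for s t
  proof -
    have "dist (x + s *\<^sub>R v + t *\<^sub>R w) x \<le> s * norm v + t * norm w"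
      using norm_triangle_ineq[of "s *\<^sub>R v" "t *\<^sub>R w"] that by (simp add: dist_norm add.assoc)
    also have "\<dots> \<le> h * norm v + h * norm w"
      using that by (intro add_mono mult_right_mono) auto
    finally show ?thesis
      using h by (simp add: algebra_simps)
  qed
  have near': "dist (x + s *\<^sub>R w + t *\<^sub>R v) x < r" if "s \<in> {0..h}" "t \<in> {0..h}" for s t
    using near[OF that(2,1)] by (simp add: algebra_simps)
  have second_difference: "\<exists>s\<in>{0..h}. \<exists>t\<in>{0..h}.
      f (x + h *\<^sub>R a + h *\<^sub>R b) - f (x + h *\<^sub>R a) - f (x + h *\<^sub>R b) + f x
      = h\<^sup>2 * G a b (x + s *\<^sub>R a + t *\<^sub>R b)"
    if "\<And>s t. s \<in> {0..h} \<Longrightarrow> t \<in> {0..h} \<Longrightarrow> x + s *\<^sub>R a + t *\<^sub>R b \<in> S" for a b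
    unfolding G_def
    by (rule second_difference_mean_value[where f' = "\<lambda>y. frechet_derivative f (at y)", OF _ _ \<open>h > 0\<close> that])
      (simp_all add: Ck_on_SucE(1)[OF C1] Ck_on_SucE(1)[OF C2])
  obtain s t where st: "s \<in> {0..h}" "t \<in> {0..h}"
    "f (x + h *\<^sub>R v + h *\<^sub>R w) - f (x + h *\<^sub>R v) - f (x + h *\<^sub>R w) + f x
      = h\<^sup>2 * G v w (x + s *\<^sub>R v + t *\<^sub>R w)"
    using second_difference[of v w] r[OF near] by metis
  obtain s' t' where st': "s' \<in> {0..h}" "t' \<in> {0..h}"
    "f (x + h *\<^sub>R w + h *\<^sub>R v) - f (x + h *\<^sub>R w) - f (x + h *\<^sub>R v) + f x
      = h\<^sup>2 * G w v (x + s' *\<^sub>R w + t' *\<^sub>R v)"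
    using second_difference[of w v] r[OF near'] by metis
  have "h\<^sup>2 * G v w (x + s *\<^sub>R v + t *\<^sub>R w) = h\<^sup>2 * G w v (x + s' *\<^sub>R w + t' *\<^sub>R v)"
    using st(3) st'(3) by (simp add: algebra_simps)
  then have "G v w (x + s *\<^sub>R v + t *\<^sub>R w) = G w v (x + s' *\<^sub>R w + t' *\<^sub>R v)"
    using \<open>h > 0\<close> by simp
  then have "\<bar>G v w x - G w v x\<bar> < 2 * e"
    using r[OF near[OF st(1,2)]] r[OF near'[OF st'(1,2)]] unfolding dist_real_def by linarith
  then show False
    by (simp add: e_def)
qed

lemma transpose_hessian:
  assumes "open S" "x \<in> S" "Ck_on 2 S F"
  shows "transpose (hessian F x) = hessian F x"
  using second_derivative_symmetric[OF assms] by (simp add: hessian_def transpose_def vec_eq_iff)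

subsection \<open>Partitioned vectors and matrices\<close>

lemma sum_UNIV_sum:
  fixes F :: "'a::finite + 'b::finite \<Rightarrow> 'c::comm_monoid_add"
  shows "(\<Sum>s\<in>UNIV. F s) = (\<Sum>i\<in>UNIV. F (Inl i)) + (\<Sum>k\<in>UNIV. F (Inr k))"
  by (simp add: UNIV_Plus_UNIV[symmetric] sum.Plus del: UNIV_Plus_UNIV)

lemma ucomp_join [simp]: "ucomp (join u w) = u"
  and wcomp_join [simp]: "wcomp (join u w) = w"
  and join_ucomp_wcomp [simp]: "join (ucomp U) (wcomp U) = U"
  by (simp_all add: ucomp_def wcomp_def join_def vec_eq_iff split: sum.split)

lemma join_eq_iff: "join u w = join u' w' \<longleftrightarrow> u = u' \<and> w = w'"
  by (metis ucomp_join wcomp_join)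

lemma join_0: "join 0 0 = 0"
  by (simp add: join_def vec_eq_iff split: sum.split)

lemma join_eq_0_iff [simp]: "join u w = 0 \<longleftrightarrow> u = 0 \<and> w = 0"
  using join_eq_iff[of u w 0 0] by (simp add: join_0)

lemma join_add: "join u w + join u' w' = join (u + u') (w + w')"
  and join_scaleR: "c *\<^sub>R join u w = join (c *\<^sub>R u) (c *\<^sub>R w)"
  by (simp_all add: join_def vec_eq_iff split: sum.split)

lemma join_sum: "(\<Sum>i\<in>I. join (u i) (w i)) = join (\<Sum>i\<in>I. u i) (\<Sum>i\<in>I. w i)"
  by (induction I rule: infinite_finite_induct) (simp_all add: join_add)

lemma inner_join: "join u w \<bullet> join u' w' = u \<bullet> u' + w \<bullet> w'"
  by (simp add: inner_vec_def sum_UNIV_sum join_def)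

lemma bounded_linear_ucomp: "bounded_linear ucomp"
  and bounded_linear_wcomp: "bounded_linear wcomp"
  by (auto intro!: linearI simp: ucomp_def wcomp_def vec_eq_iff linear_conv_bounded_linear[symmetric])

lemma blk_block_matrix [simp]:
  "blk11 (block_matrix M11 M12 M21 M22) = M11"
  "blk12 (block_matrix M11 M12 M21 M22) = M12"
  "blk21 (block_matrix M11 M12 M21 M22) = M21"
  by (simp_all add: blk11_def blk12_def blk21_def block_matrix_def vec_eq_iff)

lemma block_matrix_mult:
  "block_matrix A B C D ** block_matrix A' B' C' D' =
    block_matrix (A ** A' + B ** C') (A ** B' + B ** D') (C ** A' + D ** C') (C ** B' + D ** D')"
  by (simp add: block_matrix_def matrix_matrix_mult_def vec_eq_iff sum_UNIV_sum split: sum.split)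

lemma block_matrix_vector_mult:
  "block_matrix A B C D *v U =
    join (A *v ucomp U + B *v wcomp U) (C *v ucomp U + D *v wcomp U)"
  by (simp add: block_matrix_def matrix_vector_mult_def join_def ucomp_def wcomp_def vec_eq_iff sum_UNIV_sum split: sum.split)

lemma transpose_block_matrix:
  "transpose (block_matrix A B C D) = block_matrix (transpose A) (transpose C) (transpose B) (transpose D)"
  by (simp add: block_matrix_def transpose_def vec_eq_iff split: sum.split)

lemma block_matrix_add:
  "block_matrix A B C D + block_matrix A' B' C' D' = block_matrix (A + A') (B + B') (C + C') (D + D')"
  and uminus_block_matrix: "- block_matrix A B C D = block_matrix (- A) (- B) (- C) (- D)"
  by (simp_all add: block_matrix_def vec_eq_iff split: sum.split)

lemma matrix_zero_mult [simp]:
  "(0 :: real ^ 'm::finite ^ 'k::finite) ** (M :: real ^ 'l::finite ^ 'm) = 0"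
  "(N :: real ^ 'm ^ 'k) ** (0 :: real ^ 'l ^ 'm) = 0"
  by (simp_all add: matrix_matrix_mult_def vec_eq_iff)

lemma transpose_zero [simp]: "transpose (0 :: real ^ 'm ^ 'k) = 0"
  by (simp add: transpose_def vec_eq_iff)

lemma matrix_uminus_mult:
  fixes M :: "real ^ 'm::finite ^ 'k::finite" and N :: "real ^ 'l::finite ^ 'm"
  shows "(- M) ** N = - (M ** N)" and "M ** (- N) = - (M ** N)"
  by (simp_all add: matrix_matrix_mult_def vec_eq_iff sum_negf)

lemma uminus_mat_mult_vector [simp]: "(- mat 1 :: real ^ 'm::finite ^ 'm) *v x = - x"
  by (simp add: matrix_vector_mult_def mat_def vec_eq_iff sum_negf if_distrib[where f = "\<lambda>y. y * _"] cong: if_cong)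

lemma transpose_uminus: "transpose (- M :: real ^ 'm ^ 'k) = - transpose M"
  and transpose_add: "transpose (M + N :: real ^ 'm ^ 'k) = transpose M + transpose N"
  by (simp_all add: transpose_def vec_eq_iff)

lemma inner_matrix_vector_transpose:
  fixes M :: "real ^ 'm::finite ^ 'k::finite"
  shows "x \<bullet> (M *v y) = (transpose M *v x) \<bullet> y"
  by (metis dot_lmul_matrix vector_transpose_matrix transpose_transpose transpose_matrix_vector)

section \<open>Positive definite matrices and the block K of the symmetrizer\<close>

lemma sym_pos_def_add: "sym_pos_def M \<Longrightarrow> sym_pos_def N \<Longrightarrow> sym_pos_def (M + N)"
  by (simp add: sym_pos_def_def pos_def_def transpose_add matrix_vector_mult_add_rdistrib inner_add_right add_pos_pos)

lemma sym_pos_def_block_matrix: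
  assumes "sym_pos_def M" "sym_pos_def N"
  shows "sym_pos_def (block_matrix M 0 0 N)"
proof -
  have "0 < join u w \<bullet> (block_matrix M 0 0 N *v join u w)" if "join u w \<noteq> 0" for u w
  proof -
    have "0 \<le> u \<bullet> (M *v u)" "0 \<le> w \<bullet> (N *v w)"
      using assms by (cases "u = 0"; cases "w = 0"; force simp: sym_pos_def_def pos_def_def)+
    moreover have "0 < u \<bullet> (M *v u) \<or> 0 < w \<bullet> (N *v w)"
      using assms that by (auto simp: sym_pos_def_def pos_def_def)
    ultimately show ?thesis
      by (auto simp: block_matrix_vector_mult inner_join)
  qed
  then have "pos_def (block_matrix M 0 0 N)"
    unfolding pos_def_def by (metis join_ucomp_wcomp)
  then show ?thesis
    using assms by (simp add: sym_pos_def_def transpose_block_matrix)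
qed

text \<open>The kernel is trivial, since M x = 0 makes the quadratic form vanish at x.\<close>

lemma pos_def_invertible: "pos_def M \<Longrightarrow> invertible M"
  unfolding invertible_left_inverse matrix_left_invertible_ker pos_def_def
  by (metis inner_zero_right less_irrefl)

text \<open>\<open>K\<close> is \<open>D C\<^sup>-\<^sup>1\<close>, written so that its symmetry is visible.\<close>

lemma symmetrizer_block:
  fixes D C :: "real ^ 'm::finite ^ 'm"
  assumes D: "sym_pos_def D" and DC: "sym_pos_def (D ** C)"
  defines "K \<equiv> D ** matrix_inv (D ** C) ** D"
  shows "sym_pos_def K" and "K ** C = D"
proof -
  define N where "N = matrix_inv (D ** C)"
  have inv: "(D ** C) ** N = mat 1" "N ** (D ** C) = mat 1"
    using pos_def_invertible[of "D ** C"] DC someI_ex[of "\<lambda>N. (D ** C) ** N = mat 1 \<and> N ** (D ** C) = mat 1"]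
    by (auto simp: N_def matrix_inv_def invertible_def sym_pos_def_def)
  show "K ** C = D"
    unfolding K_def N_def[symmetric] using inv(2) by (simp add: matrix_mul_assoc[symmetric])
  \<comment> \<open>As D C is symmetric, transposing the right inverse identity makes the transpose
    of \<open>N\<close> a left inverse; left and right inverse coincide.\<close>
  have "transpose N ** (D ** C) = mat 1"
    using arg_cong[OF inv(1), of transpose] DC by (simp add: matrix_transpose_mul[of _ N] sym_pos_def_def)
  then have N: "transpose N = N"
    by (metis inv(1) matrix_mul_assoc matrix_mul_lid matrix_mul_rid)
  then have "transpose K = K"
    using D by (simp add: K_def N_def[symmetric] matrix_transpose_mul matrix_mul_assoc sym_pos_def_def)
  moreover have "0 < x \<bullet> (K *v x)" if "x \<noteq> 0" for x
  proof -
    \<comment> \<open>With this \<open>y\<close> the form of \<open>K\<close> at \<open>x\<close>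
      becomes the form of D C at \<open>y\<close>, which is positive once \<open>y\<close> is
      nonzero.\<close>
    define y where "y = N *v (D *v x)"
    have Dx: "(D ** C) *v y = D *v x"
      using arg_cong[OF inv(1), of "\<lambda>M. M *v (D *v x)"] by (simp add: y_def matrix_vector_mul_assoc matrix_mul_assoc)
    have "D *v x \<noteq> 0"
      using D that by (force simp: sym_pos_def_def pos_def_def)
    then have "y \<noteq> 0"
      using Dx by auto
    then have "0 < y \<bullet> (D *v x)"
      using DC Dx by (metis pos_def_def sym_pos_def_def)
    also have "y \<bullet> (D *v x) = x \<bullet> (D *v y)"
      using D by (metis inner_commute inner_matrix_vector_transpose sym_pos_def_def)
    also have "D *v y = K *v x"
      by (simp add: y_def K_def N_def matrix_vector_mul_assoc matrix_mul_assoc)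
    finally show ?thesis .
  qed
  ultimately show "sym_pos_def K"
    by (simp add: sym_pos_def_def pos_def_def)
qed

subsection \<open>Vectors and matrices assembled from blocks\<close>

lemma sum_UNIV_prod:
  "(\<Sum>s\<in>UNIV. F s) = (\<Sum>i\<in>UNIV. \<Sum>k\<in>UNIV. F (i, k))"
  for F :: "'a::finite \<times> 'b::finite \<Rightarrow> 'c::comm_monoid_add"
  by (simp add: sum.cartesian_product)

lemma vec_eq_iff_block:
  fixes w w' :: "real ^ ('d::finite \<times> 'n::finite)"
  shows "w = w' \<longleftrightarrow> (\<forall>i. block i w = block i w')"
  by (auto simp: block_def vec_eq_iff)

lemma block_zero [simp]: "block i 0 = 0"
  by (simp add: block_def vec_eq_iff)

lemma bounded_linear_block: "bounded_linear (block i)"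
  by (auto intro!: linearI simp: block_def vec_eq_iff linear_conv_bounded_linear[symmetric])

lemma inner_block: "x \<bullet> y = (\<Sum>i\<in>UNIV. block i x \<bullet> block i y)"
  by (simp add: inner_vec_def sum_UNIV_prod block_def)

lemma block_assemble_mult: "block i (assemble M *v x) = (\<Sum>j\<in>UNIV. M i j *v block j x)"
  by (simp add: vec_eq_iff block_def assemble_def matrix_vector_mult_def sum_UNIV_prod)

lemma assemble_mult: "assemble M ** assemble N = assemble (\<lambda>i k. \<Sum>j\<in>UNIV. M i j ** N j k)"
  by (simp add: vec_eq_iff assemble_def matrix_matrix_mult_def sum_UNIV_prod)

lemma assemble_add: "assemble (\<lambda>i j. M i j + N i j) = assemble M + assemble N"
  and assemble_scaleR: "assemble (\<lambda>i j. c *\<^sub>R M i j) = c *\<^sub>R assemble M"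
  and transpose_assemble: "transpose (assemble M) = assemble (\<lambda>i j. transpose (M j i))"
  by (simp_all add: vec_eq_iff assemble_def transpose_def)

lemma block_diag_mult_assemble: "block_diag H ** assemble M = assemble (\<lambda>i j. H ** M i j)"
proof -
  have "(\<Sum>j\<in>UNIV. (if i = j then H else 0) ** M j k) = H ** M i k" for i k
    by (simp add: if_distrib[where f = "\<lambda>N. N ** _"] cong: if_cong)
  then show ?thesis
    by (simp add: block_diag_def assemble_mult)
qed

lemma block_block_diag_mult: "block i (block_diag H *v x) = H *v block i x"
proof -
  have "(\<Sum>j\<in>UNIV. (if i = j then H else 0) *v block j x) = H *v block i x"
    by (simp add: if_distrib[where f = "\<lambda>N. N *v _"] cong: if_cong)
  then show ?thesis
    by (simp add: block_diag_def block_assemble_mult)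
qed

lemma sym_pos_def_block_diag:
  fixes H :: "real ^ 'n::finite ^ 'n"
  assumes "sym_pos_def H"
  shows "sym_pos_def (block_diag H :: real ^ ('d::finite \<times> 'n) ^ ('d \<times> 'n))"
proof -
  have "0 < x \<bullet> (block_diag H *v x)" if nz: "x \<noteq> 0" for x :: "real ^ ('d \<times> 'n)"
  proof -
    obtain i where "block i x \<noteq> 0"
      using nz unfolding vec_eq_iff_block[of x 0]
      by auto
    then have "0 < block i x \<bullet> (H *v block i x)"
      using assms by (simp add: sym_pos_def_def pos_def_def)
    moreover have "0 \<le> block j x \<bullet> (H *v block j x)" for j
      using assms by (cases "block j x = 0") (auto simp: sym_pos_def_def pos_def_def less_imp_le)
    ultimately show ?thesis
      unfolding inner_block block_block_diag_mult by (intro sum_pos2[where i = i]) auto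
  qed
  moreover have "transpose (block_diag H) = (block_diag H :: real ^ ('d \<times> 'n) ^ ('d \<times> 'n))"
    using assms by (auto simp: block_diag_def transpose_assemble sym_pos_def_def fun_eq_iff intro!: arg_cong[where f = assemble])
  ultimately show ?thesis
    by (simp add: sym_pos_def_def pos_def_def)
qed

lemma sym_pos_def_add_constant_blocks:
  fixes H :: "real ^ 'n::finite ^ 'n" and M :: "'d::finite \<Rightarrow> 'd \<Rightarrow> real ^ 'n ^ 'n"
  assumes H: "sym_pos_def H" and M: "sym_pos_def (block_diag H ** assemble M)" and "0 \<le> c"
  shows "sym_pos_def (block_diag H ** assemble (\<lambda>i j. M i j + c *\<^sub>R mat 1))"
proof -
  let ?J = "assemble (\<lambda>_ _. H) :: real ^ ('d \<times> 'n) ^ ('d \<times> 'n)"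
  have eq: "block_diag H ** assemble (\<lambda>i j. M i j + c *\<^sub>R mat 1) = block_diag H ** assemble M + c *\<^sub>R ?J"
    by (simp add: matrix_add_ldistrib assemble_add assemble_scaleR matrix_scalar_ac scalar_matrix_assoc[symmetric]
        block_diag_mult_assemble)
  have "0 \<le> x \<bullet> (?J *v x)" for x
  proof -
    \<comment> \<open>The form of \<open>?J\<close> sees only the sum of the blocks of
      \<open>x\<close>. That sum may vanish for nonzero \<open>x\<close>, so \<open>?J\<close> is
      only semidefinite and strictness comes from \<open>M\<close>.\<close>
    let ?s = "\<Sum>i\<in>UNIV. block i x"
    have "x \<bullet> (?J *v x) = ?s \<bullet> (H *v ?s)"
      by (simp add: inner_block[of x] block_assemble_mult inner_sum_left linear_sum[OF matrix_vector_mul_linear])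
    also have "\<dots> \<ge> 0"
      using H by (cases "?s = 0") (auto simp: sym_pos_def_def pos_def_def less_imp_le)
    finally show ?thesis .
  qed
  then show ?thesis
    using M H \<open>0 \<le> c\<close> unfolding eq sym_pos_def_def pos_def_def
    by (auto simp: transpose_add transpose_scalar transpose_assemble matrix_vector_mult_add_rdistrib
        inner_add_right scaleR_matrix_vector_assoc[symmetric] intro!: add_pos_nonneg)
qed

lemma block_add: "block i (x + y) = block i x + block i y"
  and block_diff: "block i (x - y) = block i x - block i y"
  and block_uminus: "block i (- x) = - block i x"
  and block_scaleR: "block i (c *\<^sub>R x) = c *\<^sub>R block i x"
  by (simp_all add: block_def vec_eq_iff)

lemma block_sum: "block i (\<Sum>j\<in>I. x j) = (\<Sum>j\<in>I. block i (x j))"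
  by (simp add: block_def vec_eq_iff)

text \<open>The embedding as the i-th block. Summing \<open>unblock i\<close> over i rebuilds a
  vector from its blocks, so regularity of the blocks passes to the whole vector by
  linearity.\<close>

definition unblock :: "'d \<Rightarrow> real ^ 'n \<Rightarrow> real ^ ('d::finite \<times> 'n::finite)" where
  "unblock i v = (\<chi> s. if fst s = i then v $ snd s else 0)"

lemma bounded_linear_unblock: "bounded_linear (unblock i)"
  by (auto intro!: linearI simp: unblock_def vec_eq_iff linear_conv_bounded_linear[symmetric])

lemma block_unblock: "block i (unblock j v) = (if i = j then v else 0)"
  by (simp add: block_def unblock_def vec_eq_iff)

text \<open>The projection E to the j-th block as a matrix. Its transpose is the embedding, and the
  off-diagonal blocks of A_j become E and C E^T.\<close>

definition block_row :: "'d \<Rightarrow> real ^ ('d::finite \<times> 'n::finite) ^ 'n" where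
  "block_row j = (\<chi> k t. if t = (j, k) then 1 else 0)"

lemma block_row_mult: "block_row j *v w = block j w"
  by (simp add: block_row_def block_def matrix_vector_mult_def vec_eq_iff if_distrib[where f = "\<lambda>x. x * _"] cong: if_cong)

text \<open>Both products are the block row with \<open>H\<close> in position j and zeros elsewhere.
  This commutation is what symmetry of A_0 A_j comes down to once K C = D is known.\<close>

lemma block_row_mult_block_diag: "block_row j ** block_diag H = H ** block_row j"
proof -
  have "(\<Sum>t\<in>UNIV. (if t = (j, k) then 1 else 0) * block_diag H $ t $ (i, l))
      = (\<Sum>m\<in>UNIV. H $ k $ m * (if (i, l) = (j, m) then 1 else 0))" for k i l
    by (simp add: if_distrib[where f = "\<lambda>x. x * _"] if_distrib[where f = "\<lambda>x. _ * x"]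
        block_diag_def assemble_def cong: if_cong)
  then show ?thesis
    by (simp add: block_row_def matrix_matrix_mult_def vec_eq_iff)
qed

lemma assemble_mult_transpose_block_row:
  "assemble M ** transpose (block_row j) = (\<chi> s l. M (fst s) j $ snd s $ l)"
  by (simp add: assemble_def block_row_def transpose_def matrix_matrix_mult_def vec_eq_iff
      if_distrib[where f = "\<lambda>x. _ * x"] cong: if_cong)

lemma block_assemble_mult_transpose_block_row:
  "block i ((assemble M ** transpose (block_row j)) *v v) = M i j *v v"
  by (simp add: assemble_mult_transpose_block_row block_def matrix_vector_mult_def vec_eq_iff)

subsection \<open>Partial derivatives\<close>

text \<open>The time line through \<open>p\<close> is an affine curve, so by the chain rule
  \<open>dt\<close> is the total derivative in direction (0, 1). With \<open>dx_eq\<close> this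
  reduces calculus for \<open>dt\<close> and \<open>dx\<close> to rules for
  \<open>has_derivative\<close>.\<close>

lemma dt_eq:
  assumes "(v has_derivative v') (at p)"
  shows "dt v p = v' (0, 1)"
proof -
  have deriv: "((\<lambda>s. v (fst p, s)) has_derivative (\<lambda>r. v' (0, r))) (at (snd p))"
    using assms by (intro has_derivative_compose[where f = "\<lambda>s. (fst p, s)" and g = v])
      (auto intro!: derivative_eq_intros)
  have lin: "v' (0, r) = r *\<^sub>R v' (0, 1)" for r
    using linear_scale[OF has_derivative_linear[OF assms], of r "(0, 1)"] by simp
  show ?thesis
    unfolding dt_def
    by (rule vector_derivative_at, unfold has_vector_derivative_def) (rule has_derivative_eq_rhs[OF deriv ext[OF lin]])
qed

lemma dx_eq:
  assumes "(v has_derivative v') (at p)"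
  shows "dx j v p = v' (axis j 1, 0)"
proof -
  have deriv: "((\<lambda>s. v (fst p + s *\<^sub>R axis j 1, snd p)) has_derivative (\<lambda>r. v' (r *\<^sub>R axis j 1, 0))) (at 0)"
    using assms by (intro has_derivative_compose[where f = "\<lambda>s. (fst p + s *\<^sub>R axis j 1, snd p)" and g = v])
      (auto intro!: derivative_eq_intros)
  have lin: "v' (r *\<^sub>R axis j 1, 0) = r *\<^sub>R v' (axis j 1, 0)" for r
    using linear_scale[OF has_derivative_linear[OF assms], of r "(axis j 1, 0)"] by simp
  show ?thesis
    unfolding dx_def
    by (rule vector_derivative_at, unfold has_vector_derivative_def) (rule has_derivative_eq_rhs[OF deriv ext[OF lin]])
qed

lemma
  assumes "bounded_linear L" "v differentiable (at p)"
  shows dt_bounded_linear: "dt (\<lambda>y. L (v y)) p = L (dt v p)"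
    and dx_bounded_linear: "dx j (\<lambda>y. L (v y)) p = L (dx j v p)"
proof -
  obtain v' where v': "(v has_derivative v') (at p)"
    using assms(2) unfolding differentiable_def by blast
  note Lv' = bounded_linear.has_derivative[OF assms(1) v']
  show "dt (\<lambda>y. L (v y)) p = L (dt v p)" "dx j (\<lambda>y. L (v y)) p = L (dx j v p)"
    by (simp_all only: dt_eq[OF v'] dt_eq[OF Lv'] dx_eq[OF v'] dx_eq[OF Lv'])
qed

lemma dx_diff:
  assumes "v differentiable (at p)" "w differentiable (at p)"
  shows "dx j (\<lambda>y. v y - w y) p = dx j v p - dx j w p"
proof -
  obtain v' w' where v': "(v has_derivative v') (at p)" and w': "(w has_derivative w') (at p)"
    using assms unfolding differentiable_def by blast
  show ?thesis
    by (simp only: dx_eq[OF v'] dx_eq[OF w'] dx_eq[OF has_derivative_diff[OF v' w']])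
qed

text \<open>The one-sided derivative is well determined, because 0 is an endpoint of a nondegenerate
  interval.\<close>

lemma deps0_scaleR: "deps0 (\<lambda>\<epsilon>. \<epsilon> *\<^sub>R c) = (c :: 'b::euclidean_space)"
  unfolding deps0_def
  by (rule vector_derivative_within_closed_interval) (auto intro!: derivative_eq_intros)

lemma deps0_const: "deps0 (\<lambda>_. c :: 'b::euclidean_space) = 0"
  unfolding deps0_def
  by (rule vector_derivative_within_closed_interval) (auto intro!: derivative_eq_intros)

lemma bounded_bilinear_matrix_vector_mult:
  "bounded_bilinear (\<lambda>(M :: real ^ 'm::finite ^ 'k::finite) v. M *v v)"
  unfolding bilinear_conv_bounded_bilinear[symmetric] bilinear_def
  by (auto intro!: linearI simp: matrix_vector_mult_add_rdistrib scaleR_matrix_vector_assoc matrix_scaleR_vector_ac matrix_vector_right_distrib)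

subsection \<open>Coefficients of the relaxation system\<close>

text \<open>One matrix stores the (2,1) blocks of all A_j: that of A_j is its j-th block column. A
  single identity K C = D thus serves every j.\<close>

definition relax_C ::
  "('d \<Rightarrow> 'd \<Rightarrow> real ^ 'n \<Rightarrow> real ^ 'n ^ 'n) \<Rightarrow> real \<Rightarrow> real ^ 'n::finite \<Rightarrow> real \<Rightarrow>
   real ^ ('d::finite \<times> 'n) ^ ('d \<times> 'n)" where
  "relax_C B a u \<epsilon> = assemble (\<lambda>i j. B i j u + (\<epsilon>\<^sup>2 * a\<^sup>2) *\<^sub>R mat 1)"

lemma relax_A_eq:
  "relax_A B a j U \<epsilon> =
    block_matrix 0 (block_row j) (relax_C B a (ucomp U) \<epsilon> ** transpose (block_row j)) 0"
  by (simp add: relax_A_def relax_C_def assemble_mult_transpose_block_row) (simp add: block_row_def)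

lemma qpart_relax_Q:
  "qpart (relax_Q f) U \<epsilon> = \<epsilon> *\<^sub>R (\<chi> s. f (fst s) (ucomp U) $ snd s) - wcomp U"
  by (simp add: qpart_def relax_Q_def block_def vec_eq_iff)

lemma block_qpart_relax_Q:
  "block i (qpart (relax_Q f) U \<epsilon>) = \<epsilon> *\<^sub>R f i (ucomp U) - block i (wcomp U)"
  by (simp add: qpart_relax_Q block_def vec_eq_iff)

lemma relax_Q_eq: "relax_Q f U \<epsilon> = join 0 (qpart (relax_Q f) U \<epsilon>)"
  by (simp add: qpart_def relax_Q_def)

text \<open>At \<epsilon> = 0 the flux term drops out and the source is linear in U, so its Jacobian
  is this constant matrix.\<close>

lemma relax_Q_0: "relax_Q f U 0 = block_matrix 0 0 0 (- mat 1) *v U"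
  by (simp add: relax_Q_eq qpart_relax_Q block_matrix_vector_mult)

lemma jacobian_matrix_vector_mult:
  fixes M :: "real ^ 'm::finite ^ 'k::finite"
  shows "jacobian (\<lambda>x. M *v x) (at z) = M"
proof -
  have "((\<lambda>x. M *v x) has_derivative (\<lambda>x. M *v x)) (at z)"
    by (intro bounded_linear_imp_has_derivative matrix_vector_mul_bounded_linear)
  then show ?thesis
    by (simp add: jacobian_def frechet_derivative_at[symmetric])
qed

lemma dwq_relax_Q: "dwq (relax_Q f) u = - mat 1"
proof -
  have "(\<lambda>w. qpart (relax_Q f) (join u w) 0) = (\<lambda>w. (- mat 1) *v w)"
    by (simp add: qpart_relax_Q fun_eq_iff)
  then show ?thesis
    by (simp only: dwq_def jacobian_matrix_vector_mult)
qed

text \<open>Differentiability of \<open>U\<close> lets \<open>dt\<close> and \<open>dx\<close>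
  commute with the linear maps \<open>ucomp\<close>, \<open>wcomp\<close> and \<open>block\<close>;
  the two systems are then compared block by block.\<close>

lemma relaxation_system_iff_first_order_system:
  fixes U :: "(real ^ 'd::finite) \<times> real \<Rightarrow> real ^ ('n::finite + 'd \<times> 'n)"
  assumes "U differentiable (at p)"
  shows "relaxation_system f B a \<epsilon> (\<lambda>y. ucomp (U y)) (\<lambda>i y. block i (wcomp (U y))) p
    \<longleftrightarrow> first_order_system (relax_A B a) (relax_Q f) \<epsilon> U p"
proof -
  have w: "bounded_linear (\<lambda>U :: real ^ ('n + 'd \<times> 'n). block i (wcomp U))" for i
    using bounded_linear_compose[OF bounded_linear_block bounded_linear_wcomp] .
  note derivs = dt_bounded_linear[OF bounded_linear_ucomp assms] dx_bounded_linear[OF bounded_linear_ucomp assms]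
    dt_bounded_linear[OF w assms] dx_bounded_linear[OF w assms]
  have A: "relax_A B a j (U p) \<epsilon> *v V = join (block j (wcomp V))
      ((relax_C B a (ucomp (U p)) \<epsilon> ** transpose (block_row j)) *v ucomp V)" for j V
    by (simp add: relax_A_eq block_matrix_vector_mult block_row_mult)
  have "first_order_system (relax_A B a) (relax_Q f) \<epsilon> U p \<longleftrightarrow>
    join (ucomp (dt U p)) (wcomp (dt U p)) + (1 / \<epsilon>) *\<^sub>R (\<Sum>j\<in>UNIV. relax_A B a j (U p) \<epsilon> *v dx j U p)
    = (1 / \<epsilon>\<^sup>2) *\<^sub>R relax_Q f (U p) \<epsilon>"
    by (simp add: first_order_system_def)
  also have "\<dots> \<longleftrightarrow> relaxation_system f B a \<epsilon> (\<lambda>y. ucomp (U y)) (\<lambda>i y. block i (wcomp (U y))) p"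
    unfolding relaxation_system_def A relax_Q_eq[of f "U p"] join_sum join_scaleR join_add join_eq_iff derivs
    by (subst vec_eq_iff_block) (simp only: block_add block_scaleR block_sum block_qpart_relax_Q relax_C_def
        block_assemble_mult_transpose_block_row scaleR_zero_right)
  finally show ?thesis ..
qed

section \<open>Smoothness of the coefficients up to \<epsilon> = 0\<close>

lemma smooth_up_toI:
  assumes "open T" "S \<subseteq> T" "\<And>k. Ck_on k T f"
  shows "smooth_up_to S f"
  using assms unfolding smooth_up_to_def smooth_on_def by blast

lemma smooth_coefficients_relaxation:
  fixes \<Omega> :: "(real ^ ('n::finite + 'd::finite \<times> 'n)) set"
  assumes spaces: "state_spaces \<Omega>u \<Omega>"
    and f: "\<And>j. smooth_on \<Omega>u (f j)" and B: "\<And>j k. smooth_on \<Omega>u (B j k)"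
  shows "smooth_coefficients \<Omega> (relax_A B a) (relax_Q f)"
    and "smooth_up_to (\<Omega> \<times> {0..1}) (\<lambda>(U, \<epsilon>). qpart (relax_Q f) U \<epsilon>)"
proof -
  \<comment> \<open>The coefficients are polynomial in \<epsilon>, so the same formulas are smooth
    for all real \<epsilon>, on an open neighbourhood of the closed parameter range.\<close>
  let ?T = "\<Omega> \<times> (UNIV :: real set)"
  have T: "open ?T" "\<Omega> \<times> {0..1} \<subseteq> ?T"
    using spaces by (auto simp: state_spaces_def intro!: open_Times)
  have u: "bounded_linear (\<lambda>y :: (real ^ ('n + 'd \<times> 'n)) \<times> real. ucomp (fst y))"
    "(\<lambda>y. ucomp (fst y)) ` ?T \<subseteq> \<Omega>u"
    using bounded_linear_compose[OF bounded_linear_ucomp bounded_linear_fst] spaces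
    by (auto simp: state_spaces_def)
  have fu: "Ck_on k ?T (\<lambda>y. f i (ucomp (fst y)))" and Bu: "Ck_on k ?T (\<lambda>y. B i j (ucomp (fst y)))" for i j k
    using f B by (auto simp: smooth_on_def intro!: Ck_on_compose_bounded_linear[OF T(1) u])
  have \<epsilon>: "Ck_on k ?T snd" for k
    by (rule Ck_on_linear[OF T(1) bounded_linear_snd])
  have "bounded_linear (\<lambda>y :: (real ^ ('n + 'd \<times> 'n)) \<times> real. wcomp (fst y))"
    using bounded_linear_compose[OF bounded_linear_wcomp bounded_linear_fst] .
  then have w: "Ck_on k ?T (\<lambda>y. (-1) *\<^sub>R wcomp (fst y))" for k
    by (intro Ck_on_scaleR[OF T(1)] Ck_on_const Ck_on_linear[OF T(1)])
  have q: "Ck_on k ?T (\<lambda>(U, \<epsilon>). qpart (relax_Q f) U \<epsilon>)" for k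
  proof -
    have "Ck_on k ?T (\<lambda>y. snd y *\<^sub>R (\<Sum>i\<in>UNIV. unblock i (f i (ucomp (fst y)))) + (-1) *\<^sub>R wcomp (fst y))"
      by (intro Ck_on_add Ck_on_scaleR Ck_on_sum T(1) \<epsilon> w Ck_on_bounded_linear[OF T(1) bounded_linear_unblock] fu)
    moreover have "qpart (relax_Q f) U \<epsilon> = \<epsilon> *\<^sub>R (\<Sum>i\<in>UNIV. unblock i (f i (ucomp U))) + (-1) *\<^sub>R wcomp U" for U \<epsilon>
      by (rule vec_eq_iff_block[THEN iffD2]) (simp add: block_qpart_relax_Q block_diff block_scaleR block_sum block_unblock)
    ultimately show ?thesis
      by (simp add: case_prod_unfold)
  qed
  then show "smooth_up_to (\<Omega> \<times> {0..1}) (\<lambda>(U, \<epsilon>). qpart (relax_Q f) U \<epsilon>)"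
    by (rule smooth_up_toI[OF T])
  have "bounded_linear (join 0 :: real ^ ('d \<times> 'n) \<Rightarrow> real ^ ('n + 'd \<times> 'n))"
    by (auto intro!: linearI simp: linear_conv_bounded_linear[symmetric] join_add join_scaleR)
  then have "Ck_on k ?T (\<lambda>y. join 0 ((\<lambda>(U, \<epsilon>). qpart (relax_Q f) U \<epsilon>) y) :: real ^ ('n + 'd \<times> 'n))" for k
    by (rule Ck_on_bounded_linear[OF T(1) _ q])
  then have Q: "Ck_on k ?T (\<lambda>(U, \<epsilon>). relax_Q f U \<epsilon>)" for k
    by (simp add: relax_Q_eq case_prod_unfold)
  have A: "Ck_on k ?T (\<lambda>(U, \<epsilon>). relax_A B a j U \<epsilon>)" for j k
  proof -
    \<comment> \<open>\<open>?L i\<close> places a matrix in block row i of the (2,1) block. Hence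
      A_j is a constant plus a sum of linear images of smooth matrices; \<epsilon> squared enters as
      an iterated scaling to suit the product rule.\<close>
    let ?L = "\<lambda>i M. block_matrix 0 0 (\<chi> s l. if fst s = i then M $ snd s $ l else 0) 0
      :: real ^ ('n + 'd \<times> 'n) ^ ('n + 'd \<times> 'n)"
    have L: "bounded_linear (?L i)" for i
      by (auto intro!: linearI simp: linear_conv_bounded_linear[symmetric] block_matrix_def vec_eq_iff split: sum.split)
    have "Ck_on k ?T (\<lambda>y. (\<Sum>i\<in>UNIV. ?L i (B i j (ucomp (fst y)) + snd y *\<^sub>R snd y *\<^sub>R a\<^sup>2 *\<^sub>R mat 1))
        + block_matrix 0 (block_row j) 0 0)"
      by (intro Ck_on_add Ck_on_sum T(1) Ck_on_bounded_linear[OF T(1) L] Bu Ck_on_scaleR \<epsilon> Ck_on_const)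
    moreover have "(\<Sum>i\<in>UNIV. ?L i (M i)) = block_matrix 0 0 (\<chi> s l. M (fst s) $ snd s $ l) 0" for M
      by (simp add: block_matrix_def vec_eq_iff split: sum.split)
    ultimately show ?thesis
      by (simp add: relax_A_def block_row_def block_matrix_add case_prod_unfold power2_eq_square mult.assoc)
  qed
  show "smooth_coefficients \<Omega> (relax_A B a) (relax_Q f)"
    unfolding smooth_coefficients_def using smooth_up_toI[OF T A] smooth_up_toI[OF T Q] by blast
qed

section \<open>Verification of the criteria (i)-(v)\<close>

lemma convergence_criteria_relaxation:
  fixes \<Omega> :: "(real ^ ('n::finite + 'd::finite \<times> 'n)) set"
  assumes spaces: "state_spaces \<Omega>u \<Omega>"
    and q: "smooth_up_to (\<Omega> \<times> {0..1}) (\<lambda>(U, \<epsilon>). qpart (relax_Q f) U \<epsilon>)"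
    and H: "\<And>u. u \<in> \<Omega>u \<Longrightarrow> sym_pos_def (H u)"
    and HB: "\<And>u. u \<in> \<Omega>u \<Longrightarrow> sym_pos_def (block_diag (H u) ** assemble (\<lambda>j k. B j k u))"
  shows "convergence_criteria \<Omega>u \<Omega> (relax_A B a) (relax_Q f)"
proof -
  define D :: "real ^ 'n \<Rightarrow> real ^ ('d \<times> 'n) ^ ('d \<times> 'n)" where "D u = block_diag (H u)" for u
  define K where "K u \<epsilon> = D u ** matrix_inv (D u ** relax_C B a u \<epsilon>) ** D u" for u \<epsilon>
  define A0 where "A0 U \<epsilon> = block_matrix (H (ucomp U)) 0 0 (K (ucomp U) \<epsilon>)"
    for U :: "real ^ ('n + 'd \<times> 'n)" and \<epsilon>
  have D: "sym_pos_def (D u)" if "u \<in> \<Omega>u" for u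
    using that by (simp add: D_def H sym_pos_def_block_diag)
  have "sym_pos_def (D u ** relax_C B a u \<epsilon>)" if "u \<in> \<Omega>u" for u \<epsilon>
    unfolding D_def relax_C_def using that by (intro sym_pos_def_add_constant_blocks H HB) auto
  \<comment> \<open>The membership of u is a premise twice, once for \<open>D\<close> and once for D
    C; later uses therefore instantiate it two times.\<close>
  note K = symmetrizer_block[OF D this, folded K_def]
  have "criterion_i \<Omega> (relax_Q f)"
    using q relax_Q_eq unfolding criterion_i_def by blast
  moreover have "criterion_ii \<Omega>u \<Omega> (relax_Q f)"
  proof -
    have "invertible (- mat 1 :: real ^ ('d \<times> 'n) ^ ('d \<times> 'n))"
      unfolding invertible_def by (intro exI[of _ "- mat 1"]) (simp add: matrix_uminus_mult)
    then show ?thesis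
      by (simp add: criterion_ii_def qpart_relax_Q dwq_relax_Q)
  qed
  moreover have "criterion_iii \<Omega> (relax_A B a) A0"
    unfolding criterion_iii_def
  proof (intro ballI conjI allI)
    fix U :: "real ^ ('n + 'd \<times> 'n)" and \<epsilon> :: real and j
    assume "U \<in> \<Omega>"
    then have u: "ucomp U \<in> \<Omega>u"
      using spaces by (simp add: state_spaces_def)
    show "sym_pos_def (A0 U \<epsilon>)"
      unfolding A0_def using u by (intro sym_pos_def_block_matrix H K(1))
    let ?C = "relax_C B a (ucomp U) \<epsilon>" and ?K = "K (ucomp U) \<epsilon>" and ?D = "D (ucomp U)" and ?H = "H (ucomp U)"
    let ?E = "block_row j :: real ^ ('d \<times> 'n) ^ 'n"
    have sym: "transpose ?K = ?K" "transpose ?D = ?D" "transpose ?H = ?H"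
      using K(1)[OF u u] D[OF u] H[OF u] by (simp_all add: sym_pos_def_def)
    have KC: "?K ** ?C = ?D"
      using K(2)[OF u u] .
    have CK: "transpose ?C ** ?K = ?D"
      using arg_cong[OF KC, of transpose] by (simp add: matrix_transpose_mul sym)
    have ED: "?E ** ?D = ?H ** ?E"
      by (simp add: D_def block_row_mult_block_diag)
    have DE: "?D ** transpose ?E = transpose ?E ** ?H"
      using arg_cong[OF ED, of transpose] by (simp add: matrix_transpose_mul sym)
    \<comment> \<open>The left side has off-diagonal blocks H E and K C E^T, the right side E C^T K
      and E^T H. By \<open>KC\<close> and \<open>CK\<close> they become H E, D E^T and E D, E^T H,
      which agree by \<open>ED\<close> and \<open>DE\<close>.\<close>
    show "A0 U \<epsilon> ** relax_A B a j U \<epsilon> = transpose (relax_A B a j U \<epsilon>) ** A0 U \<epsilon>"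
      by (simp add: A0_def relax_A_eq block_matrix_mult transpose_block_matrix matrix_transpose_mul matrix_mul_assoc KC)
        (simp add: matrix_mul_assoc[symmetric] CK ED DE)
  qed
  moreover have "criterion_iv \<Omega>u (relax_Q f) A0"
  proof -
    \<comment> \<open>Both products equal diag(0, -K); writing 2 K as a sum lets
      \<open>sym_pos_def_add\<close> apply.\<close>
    have "sym_pos_def (K u 0 + K u 0) \<and>
        A0 (join u 0) 0 ** block_matrix 0 0 0 (- mat 1) + transpose (block_matrix 0 0 0 (- mat 1)) ** A0 (join u 0) 0
        = - block_matrix 0 0 0 (K u 0 + K u 0)" if "u \<in> \<Omega>u" for u
      by (intro conjI sym_pos_def_add K(1) that) (simp add: A0_def block_matrix_mult transpose_block_matrix block_matrix_add uminus_block_matrix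
          matrix_uminus_mult transpose_uminus)
    then show ?thesis
      unfolding criterion_iv_def relax_Q_0 jacobian_matrix_vector_mult Let_def loewner_le_def
      by (intro exI[of _ "\<lambda>u. K u 0 + K u 0"]) simp
  qed
  moreover have "criterion_v \<Omega>u (relax_A B a)"
    by (simp add: criterion_v_def relax_A_eq)
  ultimately show ?thesis
    unfolding convergence_criteria_def by blast
qed

section \<open>The term w_1 and the limit equation\<close>

lemma block_w1_term_relaxation:
  fixes u0 :: "(real ^ 'd::finite) \<times> real \<Rightarrow> real ^ 'n::finite"
  shows "block i (w1_term (relax_A B a) (relax_Q f) u0 p)
    = f i (u0 p) - (\<Sum>j\<in>UNIV. B i j (u0 p) *v dx j u0 p)"
proof -
  have "matrix_inv (- mat 1 :: real ^ ('d \<times> 'n) ^ ('d \<times> 'n)) = - mat 1"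
    unfolding matrix_inv_def
    \<comment> \<open>\<open>matrix_inv\<close> is a choice, so uniqueness is checked too: any
      inverse of -I must be -I.\<close>
    by (rule some_equality) (simp_all add: matrix_uminus_mult, metis minus_minus)
  moreover have "block i (deps0 (\<lambda>\<epsilon>. qpart (relax_Q f) (join (u0 p) 0) \<epsilon>)) = f i (u0 p)"
    by (simp add: qpart_relax_Q deps0_scaleR) (simp add: block_def vec_eq_iff)
  ultimately show ?thesis
    by (simp add: w1_term_def dwq_relax_Q relax_A_eq relax_C_def block_diff block_uminus block_sum
        block_assemble_mult_transpose_block_row)
qed

lemma dx_eq_frechet_derivative:
  "v differentiable (at p) \<Longrightarrow> dx j v p = frechet_derivative v (at p) (axis j 1, 0)"
  by (simp add: dx_eq frechet_derivative_works)

lemma limit_equation_iff_viscous_conservation_law: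
  fixes u0 :: "(real ^ 'd::finite) \<times> real \<Rightarrow> real ^ 'n::finite"
    and B :: "'d \<Rightarrow> 'd \<Rightarrow> real ^ 'n \<Rightarrow> real ^ 'n ^ 'n"
  assumes f: "\<And>j. Ck_on 1 \<Omega>u (f j)" and B: "\<And>j k. Ck_on 1 \<Omega>u (B j k)"
    and "open D" "Ck_on 2 D u0" "u0 ` D \<subseteq> \<Omega>u" "p \<in> D"
  shows "limit_equation (relax_A B a) (relax_Q f) u0 p \<longleftrightarrow> viscous_conservation_law f B u0 p"
proof -
  have u0: "u0 differentiable (at y)" if "y \<in> D" for y
    using \<open>Ck_on 2 D u0\<close> that by (auto simp: numeral_2_eq_2)
  have fu: "(\<lambda>y. f j (u0 y)) differentiable (at p)"
    and Bu: "(\<lambda>y. B j k (u0 y)) differentiable (at p)" for j k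
    using f B \<open>u0 ` D \<subseteq> \<Omega>u\<close> \<open>p \<in> D\<close>
    by (auto intro!: differentiable_compose[OF _ u0])
  have "dx k u0 differentiable (at p)" for k
  proof -
    \<comment> \<open>\<open>Ck_on\<close> speaks about \<open>frechet_derivative\<close>, which is
      known to agree with \<open>dx k u0\<close> on \<open>D\<close>; openness of \<open>D\<close>
      carries differentiability over.\<close>
    have "(\<lambda>y. frechet_derivative u0 (at y) (axis k 1, 0)) differentiable (at p)"
      using \<open>Ck_on 2 D u0\<close> \<open>p \<in> D\<close> by (auto simp: numeral_2_eq_2)
    then obtain v' where "((\<lambda>y. frechet_derivative u0 (at y) (axis k 1, 0)) has_derivative v') (at p)"
      unfolding differentiable_def by blast
    then have "(dx k u0 has_derivative v') (at p)"
      using \<open>open D\<close> \<open>p \<in> D\<close>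
      by (rule has_derivative_transform_within_open) (simp add: dx_eq_frechet_derivative u0)
    then show ?thesis
      by (rule differentiableI)
  qed
  then have "(\<lambda>y. B j k (u0 y) *v dx k u0 y) differentiable (at p)" for j k
    using Bu[of j k] bounded_bilinear.FDERIV[OF bounded_bilinear_matrix_vector_mult]
    unfolding differentiable_def by blast
  then have BDu: "(\<lambda>y. \<Sum>k\<in>UNIV. B j k (u0 y) *v dx k u0 y) differentiable (at p)" for j
    by (intro differentiable_sum) auto
  let ?w = "w1_term (relax_A B a) (relax_Q f) u0"
  \<comment> \<open>Only the blocks of w_1 are known explicitly. Rebuilding w_1 from them yields its
    differentiability, which is needed to exchange \<open>block j\<close> and
    \<open>dx j\<close>.\<close>
  have "?w = (\<lambda>y. \<Sum>i\<in>UNIV. unblock i (f i (u0 y) - (\<Sum>k\<in>UNIV. B i k (u0 y) *v dx k u0 y)))"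
    by (intro ext vec_eq_iff_block[THEN iffD2]) (simp add: block_w1_term_relaxation block_sum block_unblock)
  moreover have "(\<lambda>y. unblock i (f i (u0 y) - (\<Sum>k\<in>UNIV. B i k (u0 y) *v dx k u0 y))) differentiable (at p)" for i
    using bounded_linear.has_derivative[OF bounded_linear_unblock] differentiable_diff[OF fu BDu]
    unfolding differentiable_def by blast
  ultimately have "?w differentiable (at p)"
    by (simp add: differentiable_sum)
  then have "block j (dx j ?w p) = dx j (\<lambda>y. f j (u0 y)) p - dx j (\<lambda>y. \<Sum>k\<in>UNIV. B j k (u0 y) *v dx k u0 y) p" for j
    by (simp add: dx_bounded_linear[OF bounded_linear_block, symmetric] block_w1_term_relaxation dx_diff fu BDu)
  \<comment> \<open>The (1,1) block of A_j vanishes for all U and \<epsilon>, so the last two sums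
    of \<open>limit_equation\<close> are zero; the first is the sum over j of
    \<open>block j (dx j ?w p)\<close>.\<close>
  then show ?thesis
    by (simp add: limit_equation_def viscous_conservation_law_def relax_A_eq block_row_mult deps0_const
        sum_subtractf) (simp add: algebra_simps)
qed

theorem mainTheorem4:
  fixes \<Omega>u :: "(real ^ 'n::finite) set"
    and \<Omega> :: "(real ^ ('n + 'd::finite \<times> 'n)) set"
    and f :: "'d \<Rightarrow> real ^ 'n \<Rightarrow> real ^ 'n"
    and B :: "'d \<Rightarrow> 'd \<Rightarrow> real ^ 'n \<Rightarrow> real ^ 'n ^ 'n"
    and \<eta> :: "real ^ 'n \<Rightarrow> real"
    and g :: "'d \<Rightarrow> real ^ 'n \<Rightarrow> real"
    and a :: real
  assumes spaces: "state_spaces \<Omega>u \<Omega>"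
    and f_smooth: "\<And>j. smooth_on \<Omega>u (f j)"
    and B_smooth: "\<And>j k. smooth_on \<Omega>u (B j k)"
    and entropy_smooth: "smooth_on \<Omega>u \<eta>"
    and entropy_convex: "\<And>u. u \<in> \<Omega>u \<Longrightarrow> pos_def (hessian \<eta> u)"
    and entropy_flux: "\<And>j u. u \<in> \<Omega>u \<Longrightarrow>
      (g j has_derivative (\<lambda>v. frechet_derivative \<eta> (at u) (frechet_derivative (f j) (at u) v))) (at u)"
    and viscosity: "\<And>u. u \<in> \<Omega>u \<Longrightarrow>
      sym_pos_def (block_diag (hessian \<eta> u) ** assemble (\<lambda>j k. B j k u))"
  shows
    \<comment> \<open>the relaxation system is the first-order system with coefficients \<open>relax_A\<close>, \<open>relax_Q\<close>\<close>
    "(\<forall>\<epsilon>\<in>{0<..1}. \<forall>(U :: (real ^ 'd) \<times> real \<Rightarrow> real ^ ('n + 'd \<times> 'n)) p.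
        U differentiable (at p) \<and> U p \<in> \<Omega> \<longrightarrow>
        (relaxation_system f B a \<epsilon> (\<lambda>y. ucomp (U y)) (\<lambda>i y. block i (wcomp (U y))) p
         \<longleftrightarrow> first_order_system (relax_A B a) (relax_Q f) \<epsilon> U p)) \<and>
     smooth_coefficients \<Omega> (relax_A B a) (relax_Q f) \<and>
     convergence_criteria \<Omega>u \<Omega> (relax_A B a) (relax_Q f) \<and>
     (\<forall>D (u0 :: (real ^ 'd) \<times> real \<Rightarrow> real ^ 'n). open D \<and> Ck_on 2 D u0 \<and> u0 ` D \<subseteq> \<Omega>u \<longrightarrow>
        (\<forall>p\<in>D. limit_equation (relax_A B a) (relax_Q f) u0 p
           \<longleftrightarrow> viscous_conservation_law f B u0 p))"
proof (intro conjI allI ballI impI)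
  \<comment> \<open>Convexity of the entropy supplies only \<open>pos_def\<close>; the symmetry
    comes from equality of mixed second derivatives.\<close>
  have H: "sym_pos_def (hessian \<eta> u)" if "u \<in> \<Omega>u" for u
    using transpose_hessian[of \<Omega>u u \<eta>] spaces that entropy_smooth entropy_convex[OF that]
    by (simp add: sym_pos_def_def state_spaces_def smooth_on_def)
  show "smooth_coefficients \<Omega> (relax_A B a) (relax_Q f)"
    by (rule smooth_coefficients_relaxation(1)[OF spaces f_smooth B_smooth])
  show "convergence_criteria \<Omega>u \<Omega> (relax_A B a) (relax_Q f)"
    by (rule convergence_criteria_relaxation[OF spaces
          smooth_coefficients_relaxation(2)[OF spaces f_smooth B_smooth] H viscosity])
next
  fix \<epsilon> :: real and U :: "(real ^ 'd) \<times> real \<Rightarrow> real ^ ('n + 'd \<times> 'n)" and p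
  assume "U differentiable (at p) \<and> U p \<in> \<Omega>"
  then show "relaxation_system f B a \<epsilon> (\<lambda>y. ucomp (U y)) (\<lambda>i y. block i (wcomp (U y))) p
    \<longleftrightarrow> first_order_system (relax_A B a) (relax_Q f) \<epsilon> U p"
    by (intro relaxation_system_iff_first_order_system) simp
next
  fix D and u0 :: "(real ^ 'd) \<times> real \<Rightarrow> real ^ 'n" and p
  assume "open D \<and> Ck_on 2 D u0 \<and> u0 ` D \<subseteq> \<Omega>u" and "p \<in> D"
  then show "limit_equation (relax_A B a) (relax_Q f) u0 p \<longleftrightarrow> viscous_conservation_law f B u0 p"
    using f_smooth B_smooth
    by (intro limit_equation_iff_viscous_conservation_law[of \<Omega>u]) (simp_all only: smooth_on_def)
qed

end
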